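(* Let $\mathcal C$ denote the class of nonunital $C^*$-algebras $A$ that have no maximal ideals and satisfy $\operatorname{Ped}(A)\ne A$. Let $$0\longrightarrow I\longrightarrow E\overset{\pi}{\longrightarrow}B\longrightarrow0,\qquad I\ne0,$$ be a short exact sequence of $C^*$-algebras. If $I$ and $B$ are in $\mathcal C$, then $E\in\mathcal C$. Thus $\mathcal C$ is closed under extensions.
   Context: Ideals are complex-linear two-sided ideals, not assumed norm closed. A proper ideal $J$ of $A$ satisfies $0\subsetneq J\subsetneq A$; a maximal ideal is one that is maximal among the proper ideals. $\operatorname{Ped}(A)$ is the Pedersen ideal, the smallest norm-dense ideal of $A$. *)

theory Defs
  imports "HOL-Analysis.Analysis"
begin

text \<open>Every type of class \<open>cstar_algebra\<close> is a complex C*-algebra, possibly without unit: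
  completeness comes from \<open>banach\<close>, submultiplicativity of the norm from
  \<open>real_normed_algebra\<close>.\<close>

class cstar_algebra = real_normed_algebra + banach +
  fixes scaleC :: "complex \<Rightarrow> 'a \<Rightarrow> 'a" (infixr \<open>*\<^sub>C\<close> 75)
    and star :: "'a \<Rightarrow> 'a"
  assumes scaleC_add_right: "c *\<^sub>C (x + y) = c *\<^sub>C x + c *\<^sub>C y"
    and scaleC_add_left: "(c + d) *\<^sub>C x = c *\<^sub>C x + d *\<^sub>C x"
    and scaleC_scaleC: "c *\<^sub>C d *\<^sub>C x = (c * d) *\<^sub>C x"
    and scaleC_of_real: "complex_of_real r *\<^sub>C x = r *\<^sub>R x"
    and mult_scaleC_left: "(c *\<^sub>C x) * y = c *\<^sub>C (x * y)"
    and mult_scaleC_right: "x * (c *\<^sub>C y) = c *\<^sub>C (x * y)"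
    and norm_scaleC: "norm (c *\<^sub>C x) = cmod c * norm x"
    and star_star: "star (star x) = x"
    and star_add: "star (x + y) = star x + star y"
    and star_scaleC: "star (c *\<^sub>C x) = cnj c *\<^sub>C star x"
    and star_mult: "star (x * y) = star y * star x"
    and cstar_identity: "norm (star x * x) = (norm x)\<^sup>2"

definition star_homomorphism :: "('a::cstar_algebra \<Rightarrow> 'b::cstar_algebra) \<Rightarrow> bool" where
  "star_homomorphism f \<longleftrightarrow>
     (\<forall>x y. f (x + y) = f x + f y) \<and>
     (\<forall>c x. f (c *\<^sub>C x) = c *\<^sub>C f x) \<and>
     (\<forall>x y. f (x * y) = f x * f y) \<and>
     (\<forall>x. f (star x) = star (f x))"

definition short_exact_sequence ::
    "('i::cstar_algebra \<Rightarrow> 'e::cstar_algebra) \<Rightarrow> ('e \<Rightarrow> 'b::cstar_algebra) \<Rightarrow> bool" where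
  "short_exact_sequence \<iota> \<pi> \<longleftrightarrow>
     star_homomorphism \<iota> \<and> star_homomorphism \<pi> \<and>
     inj \<iota> \<and> range \<iota> = {x. \<pi> x = 0} \<and> surj \<pi>"

text \<open>Ideals are purely algebraic; no norm closedness is required.\<close>

definition cideal :: "'a::cstar_algebra set \<Rightarrow> bool" where
  "cideal J \<longleftrightarrow>
     0 \<in> J \<and>
     (\<forall>x\<in>J. \<forall>y\<in>J. x + y \<in> J) \<and>
     (\<forall>c. \<forall>x\<in>J. c *\<^sub>C x \<in> J) \<and>
     (\<forall>a. \<forall>x\<in>J. a * x \<in> J \<and> x * a \<in> J)"

text \<open>Here the zero ideal does not count as proper, so maximality below only
  compares nonzero ideals.\<close>

definition proper_cideal :: "'a::cstar_algebra set \<Rightarrow> bool" where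
  "proper_cideal J \<longleftrightarrow> cideal J \<and> {0} \<subset> J \<and> J \<subset> UNIV"

definition maximal_cideal :: "'a::cstar_algebra set \<Rightarrow> bool" where
  "maximal_cideal M \<longleftrightarrow>
     proper_cideal M \<and> (\<forall>J. proper_cideal J \<and> M \<subseteq> J \<longrightarrow> J = M)"

definition dense_cideal :: "'a::cstar_algebra set \<Rightarrow> bool" where
  "dense_cideal J \<longleftrightarrow> cideal J \<and> closure J = UNIV"

text \<open>The Pedersen ideal is the smallest dense ideal. As usual for smallest sets it is
  written as an intersection; Pedersen's theorem says that this intersection is itself
  dense, and \<open>Ped_eqI\<close> identifies it with the least dense ideal.\<close>

definition Ped :: "'a::cstar_algebra set" where
  "Ped = \<Inter>{J. dense_cideal J}"

lemma Ped_eqI: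
  assumes "dense_cideal P" and "\<And>J. dense_cideal J \<Longrightarrow> P \<subseteq> J"
  shows "Ped = P"
  using assms unfolding Ped_def by blast

definition unital :: "'a::cstar_algebra itself \<Rightarrow> bool" where
  "unital A \<longleftrightarrow> (\<exists>e::'a. \<forall>x. e * x = x \<and> x * e = x)"

definition in_class_C :: "'a::cstar_algebra itself \<Rightarrow> bool" where
  "in_class_C A \<longleftrightarrow>
     \<not> unital A \<and>
     \<not> (\<exists>M::'a set. maximal_cideal M) \<and>
     (Ped :: 'a set) \<noteq> UNIV"

end

theory Submission
  imports Defs
begin

text \<open>A unit of \<open>E\<close> maps to a unit of \<open>B\<close>. A maximal ideal \<open>M\<close> of \<open>E\<close> either contains
  \<open>I\<close>, and then \<open>\<pi>(M)\<close> is zero or maximal in \<open>B\<close>, or satisfies \<open>I + M = E\<close>, and then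
  \<open>I / (I \<inter> M)\<close> is isomorphic to \<open>E / M\<close>, so that \<open>I \<inter> M\<close> is zero or maximal in \<open>I\<close>. Zero cannot
  be maximal among all ideals of an algebra with a dense ideal \<open>J \<noteq> A\<close>.
  For the Pedersen ideal, a dense ideal \<open>J \<noteq> B\<close> has a dense preimage because \<open>\<pi>\<close> is open.
  The open mapping theorem needs \<open>\<pi>\<close> to be continuous; *-homomorphisms are contractive since
  a self-adjoint element of norm 1 cannot be the image of one of norm less than 1, for which
  \<open>1 - c a\<close> is invertible on the whole disc \<open>\<bar>c\<bar> \<le> 1\<close>.\<close>

section \<open>Quasi-inverses\<close>

text \<open>In a unitization this says that \<open>1 + y\<close> is the inverse of \<open>1 - x\<close>.\<close>

definition quasi_inverse :: "'a::real_normed_algebra \<Rightarrow> 'a \<Rightarrow> bool" where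
  "quasi_inverse x y \<longleftrightarrow> y = x + x * y \<and> y = x + y * x"

text \<open>A left and a right inverse coincide: expanding \<open>z * y\<close> through either
  equation produces the same term \<open>z * x * y\<close>, and cancelling it leaves
  \<open>x * y = z * x\<close>.\<close>

lemma quasi_inverseI_left_right:
  fixes x :: "'a::real_normed_algebra"
  assumes "y = x + x * y" "z = x + z * x"
  shows "quasi_inverse x y"
proof -
  have "z * y = x * y + z * x * y"
    using arg_cong[OF assms(2), of "\<lambda>t. t * y"] by (simp add: distrib_right)
  moreover have "z * y = z * x + z * x * y"
    using arg_cong[OF assms(1), of "\<lambda>t. z * t"] by (simp add: distrib_left mult.assoc)
  ultimately have "x * y = z * x"
    by simp
  then have "y = z"
    using assms by simp
  then show ?thesis
    using assms unfolding quasi_inverse_def by simp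
qed

text \<open>The maps \<open>y \<mapsto> x + x * y\<close> and \<open>y \<mapsto> x + y * x\<close>
  are contractions with factor \<open>norm x\<close>; their Banach fixed points are the one-sided
  quasi-inverses.\<close>

lemma quasi_inverse_exists:
  fixes x :: "'a::{real_normed_algebra, banach}"
  assumes "norm x < 1"
  shows "\<exists>y. quasi_inverse x y"
proof -
  have dist: "dist (x + x * y) (x + x * z) \<le> norm x * dist y z"
    "dist (x + y * x) (x + z * x) \<le> norm x * dist y z" for y z
    using norm_mult_ineq[of x "y - z"] norm_mult_ineq[of "y - z" x]
    by (simp_all add: dist_norm algebra_simps)
  obtain y where "x + x * y = y"
    using banach_fix_type[of "norm x" "\<lambda>y. x + x * y"] dist(1) assms by auto
  moreover obtain z where "x + z * x = z"
    using banach_fix_type[of "norm x" "\<lambda>y. x + y * x"] dist(2) assms by auto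
  ultimately show ?thesis
    using quasi_inverseI_left_right[of y x z] by metis
qed

text \<open>This is the resolvent identity, which in a unitization reads
  \<open>y - z = (1 + y) * (x - u) * (1 + z)\<close>.\<close>

lemma quasi_inverse_diff_norm_le:
  assumes "quasi_inverse x y" "quasi_inverse u z"
  shows "norm (y - z) \<le> norm (x - u) * (1 + norm y) * (1 + norm z)"
proof -
  define d where "d = x - u"
  have yx: "y * x = y - x" and uz: "u * z = z - u"
    using assms unfolding quasi_inverse_def by (metis add_diff_cancel_left')+
  have "y * d = y - x - y * u" "d * z = x * z - (z - u)"
    "y * d * z = (y - x) * z - y * (z - u)"
    unfolding d_def by (simp_all add: algebra_simps flip: yx uz)
  then have "y - z = d + y * d + d * z + y * d * z"
    unfolding d_def by (simp add: algebra_simps)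
  also have "norm \<dots> \<le> norm d + norm y * norm d + norm d * norm z + norm y * norm d * norm z"
    by (intro norm_triangle_le add_mono norm_mult_ineq order_refl
        order_trans[OF norm_mult_ineq] mult_mono norm_ge_zero mult_nonneg_nonneg)
  also have "\<dots> = norm (x - u) * (1 + norm y) * (1 + norm z)"
    by (simp add: d_def algebra_simps)
  finally show ?thesis .
qed

text \<open>This is \<open>((1 - x)\<^sup>-\<^sup>1 + (1 + x)\<^sup>-\<^sup>1) / 2 = (1 - x\<^sup>2)\<^sup>-\<^sup>1\<close>.\<close>

lemma quasi_inverse_square:
  assumes "quasi_inverse x y" "quasi_inverse (- x) z"
  shows "quasi_inverse (x * x) ((1 / 2) *\<^sub>R (y + z))"
proof -
  have xy: "x * y = y - x" and yx: "y * x = y - x"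
    and xz: "x * z = - x - z" and zx: "z * x = - x - z"
    using assms unfolding quasi_inverse_def
    by (metis add_diff_cancel_left' mult_minus_left mult_minus_right minus_diff_eq
        diff_minus_eq_add uminus_add_conv_diff add.inverse_inverse minus_add_distrib)+
  have "x * x * (y + z) = (y + z) - 2 *\<^sub>R (x * x)"
    unfolding mult.assoc distrib_left xy xz by (simp add: algebra_simps xy xz scaleR_2)
  moreover have "(y + z) * (x * x) = (y + z) - 2 *\<^sub>R (x * x)"
    unfolding mult.assoc[symmetric] distrib_right yx zx
    by (simp add: algebra_simps yx zx scaleR_2)
  ultimately show ?thesis
    unfolding quasi_inverse_def by (simp add: scaleR_diff_right)
qed

lemma norm_quasi_inverse_le:
  assumes "quasi_inverse x y" "norm x < 1"
  shows "norm y \<le> norm x / (1 - norm x)"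
proof -
  have "norm y \<le> norm x + norm x * norm y"
    using assms(1) norm_triangle_ineq[of x "x * y"] norm_mult_ineq[of x y]
    unfolding quasi_inverse_def by (metis add_left_mono order_trans)
  then show ?thesis
    using assms(2) by (simp add: field_simps)
qed

lemma norm_le_quasi_inverse:
  assumes "quasi_inverse x y"
  shows "norm x \<le> norm y * (1 + norm x)"
proof -
  have "norm x \<le> norm y + norm x * norm y"
    using assms norm_triangle_ineq4[of y "x * y"] norm_mult_ineq[of x y]
    unfolding quasi_inverse_def by (metis add_diff_cancel_right' add_left_mono order_trans)
  then show ?thesis
    by (simp add: algebra_simps)
qed

section \<open>Automatic continuity\<close>

lemma scaleC_diff_left: "(c - d) *\<^sub>C x = c *\<^sub>C x - d *\<^sub>C (x::'a::cstar_algebra)"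
  using scaleC_add_left[of "c - d" d x] by simp

lemma scaleC_zero_right: "c *\<^sub>C 0 = (0::'a::cstar_algebra)"
  using scaleC_add_right[of c 0 0] by simp

lemma scaleC_minus_one: "(- 1) *\<^sub>C x = - (x::'a::cstar_algebra)"
  using scaleC_of_real[of "- 1" x] by simp

lemma scaleC_one: "1 *\<^sub>C x = (x::'a::cstar_algebra)"
  using scaleC_of_real[of 1 x] by simp

lemma scaleC_mult_scaleC: "(c *\<^sub>C x) * (d *\<^sub>C y) = (c * d) *\<^sub>C (x * (y::'a::cstar_algebra))"
  by (simp add: mult_scaleC_left mult_scaleC_right scaleC_scaleC mult.commute)

text \<open>The resolvent identity bounds increments of \<open>S\<close> by
  \<open>cmod (c - d)\<close> times factors that depend on \<open>S\<close> itself. It first yields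
  continuity, then compactness of the disc bounds \<open>S\<close>, and the identity becomes a
  Lipschitz estimate.\<close>

lemma quasi_inverse_lipschitz_on_disc:
  fixes b :: "'b::cstar_algebra"
  assumes S: "\<And>c. cmod c \<le> 1 \<Longrightarrow> quasi_inverse (c *\<^sub>C b) (S c)"
  obtains L where "L \<ge> 0" "\<And>c d. cmod c \<le> 1 \<Longrightarrow> cmod d \<le> 1 \<Longrightarrow> norm (S c - S d) \<le> L * cmod (c - d)"
proof -
  define s where "s c = 1 + norm (S c)" for c
  \<comment> \<open>The added 1 keeps \<open>N\<close> positive, since \<open>\<delta>\<close> below
    divides by it.\<close>
  define N where "N = norm b + 1"
  have s1: "s c \<ge> 1" for c
    by (simp add: s_def)
  have diff: "norm (S c - S d) \<le> cmod (c - d) * N * s c * s d" if "cmod c \<le> 1" "cmod d \<le> 1" for c d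
  proof -
    have "norm (S c - S d) \<le> cmod (c - d) * norm b * s c * s d"
      using quasi_inverse_diff_norm_le[OF S[OF that(1)] S[OF that(2)]]
      by (simp add: s_def norm_scaleC flip: scaleC_diff_left)
    also have "\<dots> \<le> cmod (c - d) * N * s c * s d"
      using s1[of c] s1[of d] by (intro mult_right_mono mult_left_mono) (auto simp: N_def)
    finally show ?thesis .
  qed
  have "continuous_on (cball 0 1) S"
    unfolding continuous_on_iff
  proof safe
    fix d :: complex and e :: real
    assume d: "d \<in> cball 0 1" and e: "e > 0"
    \<comment> \<open>The first bound gives \<open>t < 1/2\<close>, so that
      \<open>s c \<le> s d + s c / 2\<close> and the uncontrolled \<open>s c\<close> is at most
      \<open>2 * s d\<close>. The second then makes the increment less than
      \<open>e\<close>.\<close>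
    define \<delta> where "\<delta> = min (1 / (2 * N * s d)) (e / (2 * N * s d * s d))"
    have pos: "N > 0" "s d > 0"
      using s1[of d] by (auto simp: N_def add_nonneg_pos)
    have "dist (S c) (S d) < e" if c: "c \<in> cball 0 1" and lt: "dist c d < \<delta>" for c
    proof -
      define t where "t = cmod (c - d) * N * s d"
      have t: "t < 1 / 2" "t * (2 * s d) < e" "t \<ge> 0"
        using lt pos by (simp_all add: t_def \<delta>_def dist_norm field_simps)
      have le: "norm (S c - S d) \<le> t * s c"
        using diff[of c d] c d by (simp add: t_def mult_ac)
      have "t * s c \<le> 1 / 2 * s c"
        using t s1[of c] by (intro mult_right_mono) auto
      moreover have "s c \<le> s d + norm (S c - S d)"
        unfolding s_def using norm_triangle_sub[of "S c" "S d"] by simp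
      ultimately have "s c \<le> 2 * s d"
        using le by linarith
      then have "t * s c \<le> t * (2 * s d)"
        using t by (intro mult_left_mono) auto
      with le t show ?thesis
        by (simp add: dist_norm)
    qed
    moreover have "\<delta> > 0"
      using pos e by (auto simp: \<delta>_def)
    ultimately show "\<exists>\<delta>>0. \<forall>c\<in>cball 0 1. dist c d < \<delta> \<longrightarrow> dist (S c) (S d) < e"
      by blast
  qed
  then have "bounded (S ` cball 0 1)"
    by (intro compact_imp_bounded compact_continuous_image compact_cball)
  then obtain K where K: "\<And>c. cmod c \<le> 1 \<Longrightarrow> norm (S c) \<le> K"
    unfolding bounded_iff by (metis image_eqI mem_cball_0)
  then have sK: "s c \<le> 1 + K" if "cmod c \<le> 1" for c
    using that by (simp add: s_def)
  have "norm (S c - S d) \<le> (N * (1 + K) * (1 + K)) * cmod (c - d)" if "cmod c \<le> 1" "cmod d \<le> 1" for c d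
  proof -
    have "s c * s d \<le> (1 + K) * (1 + K)"
      using sK[OF that(1)] sK[OF that(2)] s1[of c] s1[of d] by (intro mult_mono) auto
    then have "(cmod (c - d) * N) * (s c * s d) \<le> (cmod (c - d) * N) * ((1 + K) * (1 + K))"
      by (intro mult_left_mono) (auto simp: N_def)
    then show ?thesis
      using diff[OF that] by (simp add: mult_ac)
  qed
  moreover have "N * (1 + K) * (1 + K) \<ge> 0"
    by (simp add: N_def mult.assoc)
  ultimately show ?thesis
    using that by blast
qed

text \<open>Squaring replaces a Lipschitz family of quasi-inverses of \<open>c\<^sup>n b\<^sup>n\<close> by its average over
  \<open>c\<close> and \<open>\<zeta> c\<close> with \<open>\<zeta>\<^sup>n = -1\<close>, which has the same Lipschitz constant. For \<open>n = 2\<^sup>k\<close> the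
  C*-identity keeps \<open>b\<^sup>n\<close> on the unit sphere, so that for large \<open>n\<close> the family is small at
  \<open>c < 1\<close> but not at \<open>c = 1\<close>.\<close>

lemma self_adjoint_not_quasi_invertible:
  fixes b :: "'b::cstar_algebra"
  assumes sa: "star b = b" and nb: "norm b = 1"
  shows "\<exists>c. cmod c \<le> 1 \<and> \<not> (\<exists>y. quasi_inverse (c *\<^sub>C b) y)"
proof (rule ccontr)
  assume "\<not> ?thesis"
  then obtain S where S: "\<And>c. cmod c \<le> 1 \<Longrightarrow> quasi_inverse (c *\<^sub>C b) (S c)"
    by metis
  obtain L where L: "L \<ge> 0"
    "\<And>c d. cmod c \<le> 1 \<Longrightarrow> cmod d \<le> 1 \<Longrightarrow> norm (S c - S d) \<le> L * cmod (c - d)"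
    using quasi_inverse_lipschitz_on_disc[OF S] by blast
  have family: "\<exists>a G. norm a = 1 \<and> star a = a \<and>
      (\<forall>c. cmod c \<le> 1 \<longrightarrow> quasi_inverse (c ^ (2 ^ k) *\<^sub>C a) (G c)) \<and>
      (\<forall>c d. cmod c \<le> 1 \<longrightarrow> cmod d \<le> 1 \<longrightarrow> norm (G c - G d :: 'b) \<le> L * cmod (c - d))" for k :: nat
  proof (induction k)
    case 0
    show ?case
      using sa nb S L by (intro exI[of _ b] exI[of _ S]) auto
  next
    case (Suc k)
    then obtain a and G :: "complex \<Rightarrow> 'b" where a: "norm a = 1" "star a = a"
      and G: "\<And>c. cmod c \<le> 1 \<Longrightarrow> quasi_inverse (c ^ (2 ^ k) *\<^sub>C a) (G c)"
      and GL: "\<And>c d. cmod c \<le> 1 \<Longrightarrow> cmod d \<le> 1 \<Longrightarrow> norm (G c - G d) \<le> L * cmod (c - d)"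
      by blast
    define \<zeta> where "\<zeta> = cis (pi / 2 ^ k)"
    have \<zeta>: "cmod \<zeta> = 1" "\<zeta> ^ (2 ^ k) = - 1"
      by (simp_all add: \<zeta>_def Complex.DeMoivre)
    define H where "H c = (1 / 2) *\<^sub>R (G c + G (\<zeta> * c))" for c
    have "quasi_inverse (c ^ (2 ^ Suc k) *\<^sub>C (a * a)) (H c)" if c: "cmod c \<le> 1" for c
    proof -
      have "quasi_inverse (- (c ^ (2 ^ k) *\<^sub>C a)) (G (\<zeta> * c))"
        using G[of "\<zeta> * c"] c \<zeta>
        by (simp add: norm_mult power_mult_distrib flip: scaleC_minus_one scaleC_scaleC)
          (simp add: scaleC_scaleC)
      from quasi_inverse_square[OF G[OF c] this] show ?thesis
        by (simp add: H_def scaleC_mult_scaleC mult_2 power_add)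
    qed
    moreover have "norm (H c - H d) \<le> L * cmod (c - d)" if "cmod c \<le> 1" "cmod d \<le> 1" for c d
    proof -
      have "H c - H d = (1 / 2) *\<^sub>R ((G c - G d) + (G (\<zeta> * c) - G (\<zeta> * d)))"
        by (simp add: H_def algebra_simps)
      moreover have "norm (G (\<zeta> * c) - G (\<zeta> * d)) \<le> L * cmod (c - d)"
        using GL[of "\<zeta> * c" "\<zeta> * d"] that \<zeta> by (simp add: norm_mult flip: right_diff_distrib)
      ultimately show ?thesis
        using GL[OF that] norm_triangle_ineq[of "G c - G d" "G (\<zeta> * c) - G (\<zeta> * d)"] by simp
    qed
    moreover have "norm (a * a) = 1" "star (a * a) = a * a"
      using cstar_identity[of a] a by (simp_all add: star_mult)
    ultimately show ?case
      by blast
  qed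
  \<comment> \<open>This forces \<open>L * (1 - \<mu>) \<le> 1/8\<close>; the summand 1 keeps
    \<open>\<mu>\<close> positive for every \<open>L \<ge> 0\<close>. The contradiction comes from
    \<open>norm (G 1) \<ge> 1/2\<close> against \<open>norm (G \<mu>) \<le> 1/4\<close>, a gap
    larger than 1/8.\<close>
  define \<mu> where "\<mu> = 1 - 1 / (8 * (L + 1))"
  have \<mu>: "0 < \<mu>" "\<mu> < 1" "L * (1 - \<mu>) \<le> 1 / 8"
    using L(1) by (auto simp: \<mu>_def field_simps)
  \<comment> \<open>The map \<open>t \<mapsto> t / (1 - t)\<close> sends 1/5 to 1/4, and
    \<open>2 ^ n \<ge> n\<close> keeps the power of \<open>\<mu>\<close> below 1/5.\<close>
  obtain n where n: "\<mu> ^ n < 1 / 5"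
    using real_arch_pow_inv[of "1 / 5" \<mu>] \<mu> by auto
  have p: "\<mu> ^ (2 ^ n) < 1 / 5"
    using power_decreasing[of n "2 ^ n" \<mu>] n \<mu> less_imp_le[OF less_exp[of n]] by linarith
  obtain a and G :: "complex \<Rightarrow> 'b" where a: "norm a = 1"
    and G: "\<And>c. cmod c \<le> 1 \<Longrightarrow> quasi_inverse (c ^ (2 ^ n) *\<^sub>C a) (G c)"
    and GL: "\<And>c d. cmod c \<le> 1 \<Longrightarrow> cmod d \<le> 1 \<Longrightarrow> norm (G c - G d) \<le> L * cmod (c - d)"
    using family[of n] by blast
  have "1 - of_real \<mu> = complex_of_real (1 - \<mu>)"
    by simp
  then have cm: "cmod (of_real \<mu>) = \<mu>" "cmod (1 - of_real \<mu>) = 1 - \<mu>"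
    using \<mu> by (simp_all only: norm_of_real abs_of_pos diff_gt_0_iff_gt)
  have "1 / 2 \<le> norm (G 1)"
    using norm_le_quasi_inverse[OF G[of 1]] a by (simp add: scaleC_one)
  moreover have "norm (G 1 - G (of_real \<mu>)) \<le> L * (1 - \<mu>)"
    using GL[of 1 "of_real \<mu>"] less_imp_le[OF \<mu>(2)] unfolding cm by simp
  moreover have "norm (G (of_real \<mu>)) \<le> 1 / 4"
  proof -
    have "norm (of_real \<mu> ^ (2 ^ n) *\<^sub>C a) = \<mu> ^ (2 ^ n)"
      using a \<mu> by (simp add: norm_scaleC norm_power)
    then have "norm (G (of_real \<mu>)) \<le> \<mu> ^ (2 ^ n) / (1 - \<mu> ^ (2 ^ n))"
      using norm_quasi_inverse_le[OF G[of "of_real \<mu>"]] \<mu> p cm by simp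
    also have "\<dots> \<le> 1 / 4"
      using p by (simp add: field_simps)
    finally show ?thesis .
  qed
  ultimately show False
    using norm_triangle_sub[of "G 1" "G (of_real \<mu>)"] \<mu>(3) by linarith
qed

section \<open>Contractivity of star-homomorphisms\<close>

lemma star_homomorphismD:
  assumes "star_homomorphism f"
  shows "f (x + y) = f x + f y" "f (c *\<^sub>C x) = c *\<^sub>C f x" "f (x * y) = f x * f y"
    "f (star x) = star (f x)" "f 0 = 0" "f (r *\<^sub>R x) = r *\<^sub>R f x" "f (- x) = - f x" "f (x - y) = f x - f y"
proof -
  show add: "f (x + y) = f x + f y" and sc: "f (c *\<^sub>C x) = c *\<^sub>C f x" and "f (x * y) = f x * f y"
    and "f (star x) = star (f x)" for x y c
    using assms unfolding star_homomorphism_def by blast+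
  show zero: "f 0 = 0"
    using add[of 0 0] by simp
  show "f (r *\<^sub>R x) = r *\<^sub>R f x"
    using sc[of "of_real r" x] by (simp add: scaleC_of_real)
  show m: "f (- x) = - f x" for x
    using add[of x "- x"] zero by (simp add: eq_neg_iff_add_eq_0 add.commute)
  show "f (x - y) = f x - f y"
    using add[of x "- y"] m by simp
qed

text \<open>Homomorphisms preserve quasi-inverses. If the bound failed, rescaling would give
  \<open>norm x < 1\<close> and \<open>norm (f x) = 1\<close>, so all \<open>c *\<^sub>C f x\<close>
  on the disc would be quasi-invertible.\<close>

lemma star_homomorphism_norm_le_self_adjoint:
  assumes f: "star_homomorphism f" and sa: "star a = a"
  shows "norm (f a) \<le> norm a"
proof (rule ccontr)
  assume "\<not> ?thesis"
  then have lt: "norm a < norm (f a)" by simp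
  define x where "x = inverse (norm (f a)) *\<^sub>R a"
  have pos: "norm (f a) > 0"
    using lt norm_ge_zero[of a] by linarith
  have fx: "norm (f x) = 1"
    using pos by (simp add: x_def star_homomorphismD[OF f])
  have "star x = x"
    using sa star_scaleC[of "of_real (inverse (norm (f a)))" a]
    by (simp only: x_def scaleC_of_real complex_cnj_complex_of_real)
  then have "star (f x) = f x"
    using star_homomorphismD(4)[OF f, of x] by simp
  then obtain c where c: "cmod c \<le> 1" "\<not> (\<exists>y. quasi_inverse (c *\<^sub>C f x) y)"
    using self_adjoint_not_quasi_invertible fx by blast
  have "norm x < 1"
    using lt pos by (simp add: x_def field_simps)
  then have "norm (c *\<^sub>C x) < 1"
    using mult_right_mono[OF c(1) norm_ge_zero[of x]] by (simp add: norm_scaleC)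
  then obtain y where "quasi_inverse (c *\<^sub>C x) y"
    using quasi_inverse_exists by blast
  then have "quasi_inverse (c *\<^sub>C f x) (f y)"
    unfolding quasi_inverse_def by (metis star_homomorphismD(1-3)[OF f])
  with c show False by blast
qed

text \<open>The C*-identity reduces the claim to the self-adjoint element
  \<open>star x * x\<close>.\<close>

lemma star_homomorphism_norm_le:
  assumes f: "star_homomorphism f"
  shows "norm (f x) \<le> norm x"
proof -
  have "(norm (f x))\<^sup>2 = norm (f (star x * x))"
    by (simp add: star_homomorphismD[OF f] cstar_identity)
  also have "\<dots> \<le> norm (star x * x)"
    by (intro star_homomorphism_norm_le_self_adjoint[OF f]) (simp add: star_mult star_star)
  finally show ?thesis
    by (simp add: cstar_identity power2_le_iff_abs_le)
qed

lemma star_homomorphism_bounded_linear: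
  assumes "star_homomorphism f"
  shows "bounded_linear f"
  using star_homomorphism_norm_le[OF assms]
  by (intro bounded_linear_intro[where K = 1]) (simp_all add: star_homomorphismD[OF assms])

section \<open>Bounded lifts along surjections\<close>

text \<open>The Baire half of the open mapping theorem: the closed sets \<open>C n\<close> cover the
  target, so one contains a ball. Differences of approximate preimages of points of that ball lift
  small vectors up to a controlled error.\<close>

lemma surj_approximate_lift:
  fixes f :: "'a::real_normed_vector \<Rightarrow> 'b::banach"
  assumes f: "bounded_linear f" and "surj f"
  obtains K where "K \<ge> 0" "\<And>v. \<exists>x. norm x \<le> K * norm v \<and> norm (v - f x) \<le> norm v / 2"
proof -
  interpret bounded_linear f by (rule f)
  define C where "C n = closure (f ` cball 0 (real n))" for n
  have "v \<in> (\<Union>n. C n)" for v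
  proof -
    obtain x where x: "f x = v"
      using \<open>surj f\<close> by (metis surjD)
    obtain n where "norm x \<le> real n"
      using real_arch_simple by blast
    then have "v \<in> f ` cball 0 (real n)"
      using x by auto
    then have "v \<in> C n"
      unfolding C_def by (rule subsetD[OF closure_subset])
    then show ?thesis
      by blast
  qed
  then have "(\<Union>n. C n) = UNIV"
    by blast
  then have "interior (\<Union>n. C n) \<noteq> {}"
    by simp
  moreover have "interior (\<Union>n. C n) = {}" if empty: "\<And>n. interior (C n) = {}"
  proof -
    have "euclidean interior_of \<Union>(range C) = {}"
    proof (rule Baire_category_alt)
      show "closedin euclidean T \<and> euclidean interior_of T = {}" if "T \<in> range C" for T
        using that empty by (auto simp: C_def)
    qed (use completely_metrizable_space_euclidean in auto)
    then show ?thesis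
      by simp
  qed
  ultimately have "\<exists>n. interior (C n) \<noteq> {}"
    by blast
  then obtain n y where "y \<in> interior (C n)" by blast
  then obtain r where r: "r > 0" "ball y r \<subseteq> C n"
    using mem_interior[of y "C n"] by blast
  have approx: "\<exists>x. norm x \<le> real n \<and> norm (f x - u) < r / 8" if "u \<in> ball y r" for u
  proof -
    have "u \<in> closure (f ` cball 0 (real n))"
      using r that by (auto simp: C_def)
    then obtain z where "z \<in> f ` cball 0 (real n)" "dist z u < r / 8"
      using r(1) closure_approachable[of u] by (metis zero_less_divide_iff zero_less_numeral)
    then show ?thesis
      by (auto simp: dist_norm)
  qed
  have "\<exists>x. norm x \<le> (4 * real n / r) * norm v \<and> norm (v - f x) \<le> norm v / 2" for v
  proof (cases "v = 0")
    case True
    then show ?thesis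
      by (intro exI[of _ 0]) (simp add: zero)
  next
    case False
    \<comment> \<open>Length \<open>r / 2\<close> keeps \<open>y + w\<close> inside the ball, and
      two errors of \<open>r / 8\<close> add up to half of \<open>norm w\<close>. Scaling back by
      \<open>t\<close> gives the constant \<open>4 * n / r\<close>.\<close>
    define w where "w = (r / (2 * norm v)) *\<^sub>R v"
    have nw: "norm w = r / 2"
      using False r by (simp add: w_def)
    have "y + w \<in> ball y r" "y \<in> ball y r"
      using nw r by (auto simp: dist_norm)
    then obtain x1 x2 where x: "norm x1 \<le> n" "norm (f x1 - (y + w)) < r / 8"
      "norm x2 \<le> n" "norm (f x2 - y) < r / 8"
      using approx by meson
    define t where "t = 2 * norm v / r"
    have t: "t \<ge> 0"
      using r by (simp add: t_def)
    have v: "v = t *\<^sub>R w"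
      using False r by (simp add: w_def t_def)
    have "v - f (t *\<^sub>R (x1 - x2)) = t *\<^sub>R ((f x2 - y) - (f x1 - (y + w)))"
      by (subst v) (simp add: scaleR diff algebra_simps)
    moreover have "norm ((f x2 - y) - (f x1 - (y + w))) \<le> r / 4"
      using norm_triangle_ineq4[of "f x2 - y" "f x1 - (y + w)"] x by simp
    ultimately have "norm (v - f (t *\<^sub>R (x1 - x2))) \<le> t * (r / 4)"
      using t by (simp only: norm_scaleR abs_of_nonneg mult_left_mono)
    moreover have "norm (x1 - x2) \<le> 2 * n"
      using norm_triangle_ineq4[of x1 x2] x by simp
    then have "norm (t *\<^sub>R (x1 - x2)) \<le> t * (2 * n)"
      using t by (simp only: norm_scaleR abs_of_nonneg mult_left_mono)
    ultimately show ?thesis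
      using r by (intro exI[of _ "t *\<^sub>R (x1 - x2)"]) (simp add: t_def mult_ac)
  qed
  then show ?thesis
    using that[of "4 * real n / r"] r by simp
qed

text \<open>Successive approximation: lifting each remainder \<open>r n\<close> halves it, so the
  lifts form an absolutely convergent series, whose images telescope to \<open>v\<close>. The
  geometric series costs the factor 2.\<close>

lemma surj_bounded_lift:
  fixes f :: "'a::banach \<Rightarrow> 'b::banach"
  assumes f: "bounded_linear f" and "surj f"
  obtains K where "K \<ge> 0" "\<And>v. \<exists>x. f x = v \<and> norm x \<le> K * norm v"
proof -
  interpret bounded_linear f by (rule f)
  obtain K where K: "K \<ge> 0" "\<And>v. \<exists>x. norm x \<le> K * norm v \<and> norm (v - f x) \<le> norm v / 2"
    using surj_approximate_lift[OF assms] by blast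
  then obtain g where g: "\<And>v. norm (g v) \<le> K * norm v" "\<And>v. norm (v - f (g v)) \<le> norm v / 2"
    by metis
  have "\<exists>x. f x = v \<and> norm x \<le> (2 * K) * norm v" for v
  proof -
    define r where "r n = ((\<lambda>v. v - f (g v)) ^^ n) v" for n
    have r: "r 0 = v" "r (Suc n) = r n - f (g (r n))" for n
      by (simp_all add: r_def)
    have nr: "norm (r n) \<le> norm v * (1 / 2) ^ n" for n
    proof (induction n)
      case (Suc n)
      then show ?case
        using g(2)[of "r n"] by (simp add: r)
    qed (simp add: r)
    have ng: "norm (g (r n)) \<le> (K * norm v) * (1 / 2) ^ n" for n
      using g(1)[of "r n"] mult_left_mono[OF nr[of n] K(1)] by (simp add: mult_ac)
    have geo: "(\<lambda>n. (K * norm v) * (1 / 2) ^ n) sums ((K * norm v) * 2)"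
      using sums_mult[OF geometric_sums[of "1 / 2 :: real"]] by simp
    have summable: "summable (\<lambda>n. norm (g (r n)))"
      by (rule summable_comparison_test[OF _ sums_summable[OF geo]]) (use ng in auto)
    have "r \<longlonglongrightarrow> 0"
    proof (rule Lim_null_comparison)
      show "\<forall>\<^sub>F n in sequentially. norm (r n) \<le> norm v * (1 / 2) ^ n"
        using nr by simp
      show "(\<lambda>n. norm v * (1 / 2) ^ n) \<longlonglongrightarrow> 0"
        by (intro tendsto_mult_right_zero LIMSEQ_power_zero) simp
    qed
    then have "(\<lambda>n. r n - r (Suc n)) sums (v - 0)"
      using telescope_sums'[of r 0] r(1) by simp
    then have "(\<lambda>n. f (g (r n))) sums v"
      by (simp add: r(2))
    moreover have "f (\<Sum>n. g (r n)) = (\<Sum>n. f (g (r n)))"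
      using suminf[OF summable_norm_cancel[OF summable]] by simp
    ultimately have "f (\<Sum>n. g (r n)) = v"
      by (simp add: sums_iff)
    moreover have "norm (\<Sum>n. g (r n)) \<le> (2 * K) * norm v"
    proof -
      have "norm (\<Sum>n. g (r n)) \<le> (\<Sum>n. norm (g (r n)))"
        by (rule summable_norm[OF summable])
      also have "\<dots> \<le> (\<Sum>n. (K * norm v) * (1 / 2) ^ n)"
        using ng summable geo by (intro suminf_le) (auto simp: sums_iff)
      finally show ?thesis
        using geo by (simp add: sums_iff mult_ac)
    qed
    ultimately show ?thesis by blast
  qed
  then show ?thesis
    using that[of "2 * K"] K(1) by simp
qed

section \<open>Ideals\<close>

lemma cidealD:
  assumes "cideal J"
  shows "0 \<in> J" "x \<in> J \<Longrightarrow> y \<in> J \<Longrightarrow> x + y \<in> J" "x \<in> J \<Longrightarrow> c *\<^sub>C x \<in> J"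
    "x \<in> J \<Longrightarrow> a * x \<in> J" "x \<in> J \<Longrightarrow> x * a \<in> J"
  using assms unfolding cideal_def by auto

lemma cideal_vimage:
  assumes f: "star_homomorphism f" and "cideal J"
  shows "cideal (f -` J)"
  using cidealD[OF assms(2)] unfolding cideal_def by (simp add: star_homomorphismD[OF f])

lemma cideal_image:
  assumes f: "star_homomorphism f" "surj f" and J: "cideal J"
  shows "cideal (f ` J)"
  unfolding cideal_def
proof (intro conjI ballI allI)
  show "0 \<in> f ` J"
    using cidealD(1)[OF J] star_homomorphismD(5)[OF f(1)] by (metis image_eqI)
next
  fix x y assume "x \<in> f ` J" "y \<in> f ` J"
  then show "x + y \<in> f ` J"
    using cidealD(2)[OF J] by (auto simp flip: star_homomorphismD(1)[OF f(1)])
next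
  fix c x assume "x \<in> f ` J"
  then show "c *\<^sub>C x \<in> f ` J"
    using cidealD(3)[OF J] by (auto simp flip: star_homomorphismD(2)[OF f(1)])
next
  fix a x assume "x \<in> f ` J"
  moreover obtain e where "a = f e"
    using f(2) by (metis surjD)
  ultimately show "a * x \<in> f ` J" "x * a \<in> f ` J"
    using cidealD(4,5)[OF J] by (auto simp flip: star_homomorphismD(3)[OF f(1)])
qed

text \<open>Approximate \<open>f x\<close> by some \<open>j\<close> in \<open>J\<close>, then
  correct \<open>x\<close> by a small lift of \<open>j - f x\<close>.\<close>

lemma dense_cideal_vimage:
  fixes f :: "'a::cstar_algebra \<Rightarrow> 'b::cstar_algebra"
  assumes f: "star_homomorphism f" "surj f" and J: "dense_cideal J"
  shows "dense_cideal (f -` J)"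
proof -
  obtain K where K: "K \<ge> 0" "\<And>v. \<exists>x. f x = v \<and> norm x \<le> K * norm v"
    using surj_bounded_lift[OF star_homomorphism_bounded_linear[OF f(1)] f(2)] by blast
  have "x \<in> closure (f -` J)" for x
    unfolding closure_approachable
  proof (intro allI impI)
    fix e :: real assume e: "e > 0"
    have "f x \<in> closure J"
      using J by (simp add: dense_cideal_def)
    then obtain j where j: "j \<in> J" "dist j (f x) < e / (K + 1)"
      using e K(1) unfolding closure_approachable by (metis add_nonneg_pos divide_pos_pos zero_less_one)
    obtain z where z: "f z = j - f x" "norm z \<le> K * norm (j - f x)"
      using K(2) by blast
    have "norm z \<le> (K + 1) * norm (j - f x)"
      using z(2) norm_ge_zero[of "j - f x"] unfolding distrib_right by linarith
    also have "\<dots> < e"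
      using j(2) K(1) by (simp add: dist_norm field_simps)
    finally have "dist (x + z) x < e"
      by (simp add: dist_norm)
    moreover have "x + z \<in> f -` J"
      using j(1) z(1) by (simp add: star_homomorphismD[OF f(1)])
    ultimately show "\<exists>y\<in>f -` J. dist y x < e" by blast
  qed
  then show ?thesis
    using cideal_vimage[OF f(1)] J unfolding dense_cideal_def by auto
qed

text \<open>Turns the Pedersen condition into a dense ideal that can be pulled back along
  \<open>\<pi>\<close>.\<close>

lemma Ped_neq_UNIV_iff:
  "(Ped :: 'a::cstar_algebra set) \<noteq> UNIV \<longleftrightarrow> (\<exists>J::'a set. dense_cideal J \<and> J \<noteq> UNIV)"
  unfolding Ped_def by blast

text \<open>As \<open>M\<close> is nonzero, so is \<open>L\<close>; hence \<open>L\<close> is proper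
  unless it is everything.\<close>

lemma maximal_cideal_dichotomy:
  assumes "maximal_cideal M" "cideal L" "M \<subseteq> L"
  shows "L = M \<or> L = UNIV"
  using assms unfolding maximal_cideal_def proper_cideal_def by blast

text \<open>If \<open>N = 0\<close>, the larger ideal is the dense one witnessing \<open>Ped \<noteq> UNIV\<close>.\<close>

lemma in_class_C_larger_cideal:
  fixes N :: "'a::cstar_algebra set"
  assumes C: "in_class_C TYPE('a)" and N: "cideal N" "N \<noteq> UNIV"
  obtains K where "cideal K" "K \<noteq> UNIV" "N \<subset> K"
proof (cases "N = {0}")
  case True
  obtain J :: "'a set" where J: "dense_cideal J" "J \<noteq> UNIV"
    using C Ped_neq_UNIV_iff unfolding in_class_C_def by blast
  \<comment> \<open>The set \<open>{0}\<close> is closed, so its density would make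
    \<open>N = {0}\<close> the whole algebra.\<close>
  have "J \<noteq> {0}"
    using J True N by (auto simp: dense_cideal_def)
  then have "N \<subset> J"
    using True J cidealD(1)[of J] by (auto simp: dense_cideal_def)
  then show ?thesis
    using that J by (auto simp: dense_cideal_def)
next
  case False
  then have "proper_cideal N"
    using N cidealD(1)[OF N(1)] by (auto simp: proper_cideal_def)
  then obtain K where "proper_cideal K" "N \<subseteq> K" "K \<noteq> N"
    using C unfolding in_class_C_def maximal_cideal_def by blast
  then show ?thesis
    using that by (auto simp: proper_cideal_def)
qed

lemma cideal_sum:
  assumes A: "0 \<in> A" "\<And>x y. x \<in> A \<Longrightarrow> y \<in> A \<Longrightarrow> x + y \<in> A"
      "\<And>c x. x \<in> A \<Longrightarrow> c *\<^sub>C x \<in> A"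
    and M: "cideal M"
    and absorb: "\<And>e x. x \<in> A \<Longrightarrow> \<exists>a\<in>A. \<exists>m\<in>M. e * x = a + m"
      "\<And>e x. x \<in> A \<Longrightarrow> \<exists>a\<in>A. \<exists>m\<in>M. x * e = a + m"
  shows "cideal {a + m |a m. a \<in> A \<and> m \<in> M}" (is "cideal ?L")
  unfolding cideal_def
proof (intro conjI ballI allI)
  show "0 \<in> ?L"
    using A(1) cidealD(1)[OF M] by force
next
  fix x y assume "x \<in> ?L" "y \<in> ?L"
  then obtain a m b n where "x = a + m" "y = b + n" "a \<in> A" "b \<in> A" "m \<in> M" "n \<in> M"
    by blast
  moreover have "a + m + (b + n) = (a + b) + (m + n)"
    by (simp add: algebra_simps)
  ultimately show "x + y \<in> ?L"
    using A(2) cidealD(2)[OF M] by blast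
next
  fix c x assume "x \<in> ?L"
  then show "c *\<^sub>C x \<in> ?L"
    using A(3) cidealD(3)[OF M] scaleC_add_right by blast
next
  fix e x assume "x \<in> ?L"
  then obtain a m where x: "x = a + m" "a \<in> A" "m \<in> M"
    by blast
  obtain b n where b: "e * a = b + n" "b \<in> A" "n \<in> M"
    using absorb(1)[OF x(2)] by blast
  obtain d k where d: "a * e = d + k" "d \<in> A" "k \<in> M"
    using absorb(2)[OF x(2)] by blast
  have "e * x = b + (n + e * m)" "x * e = d + (k + m * e)"
    using x(1) b(1) d(1) by (simp_all add: distrib_left distrib_right add.assoc)
  then show "e * x \<in> ?L" "x * e \<in> ?L"
    using b d cidealD(2)[OF M] cidealD(4,5)[OF M x(3)] by blast+
qed

lemma unital_surj_image:
  fixes f :: "'a::cstar_algebra \<Rightarrow> 'b::cstar_algebra"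
  assumes "star_homomorphism f" "surj f" "unital TYPE('a)"
  shows "unital TYPE('b)"
  using assms unfolding unital_def by (metis star_homomorphismD(3) surjD)

section \<open>Ideals of an extension\<close>

theorem theorem7p2:
  fixes \<iota> :: "'i::cstar_algebra \<Rightarrow> 'e::cstar_algebra"
    and \<pi> :: "'e \<Rightarrow> 'b::cstar_algebra"
  assumes "short_exact_sequence \<iota> \<pi>"
    and "(UNIV :: 'i set) \<noteq> {0}"
    and "in_class_C TYPE('i)"
    and "in_class_C TYPE('b)"
  shows "in_class_C TYPE('e)"
proof -
  have i: "star_homomorphism \<iota>" and p: "star_homomorphism \<pi>" "surj \<pi>"
    and exact: "range \<iota> = {x. \<pi> x = 0}"
    using assms(1) unfolding short_exact_sequence_def by auto
  have ker: "cideal (range \<iota>)"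
    using cideal_vimage[OF p(1), of "{0}"]
    by (simp add: exact vimage_def cideal_def scaleC_zero_right star_homomorphismD[OF p(1)])
  have "\<not> unital TYPE('e)"
    using unital_surj_image[OF p] assms(4) unfolding in_class_C_def by blast
  moreover have "(Ped :: 'e set) \<noteq> UNIV"
  proof -
    obtain J :: "'b set" where J: "dense_cideal J" "J \<noteq> UNIV"
      using assms(4) Ped_neq_UNIV_iff unfolding in_class_C_def by blast
    then have "\<pi> -` J \<noteq> UNIV"
      using p(2) by (metis surj_image_vimage_eq)
    then show ?thesis
      using dense_cideal_vimage[OF p J(1)] Ped_neq_UNIV_iff by blast
  qed
  moreover have False if M: "maximal_cideal M" for M :: "'e set"
  proof (cases "range \<iota> \<subseteq> M")
    case True
    have cM: "cideal M" "M \<noteq> UNIV"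
      using M unfolding maximal_cideal_def proper_cideal_def by auto
    \<comment> \<open>\<open>M\<close> contains the kernel, hence is a union of fibres of
      \<open>\<pi>\<close>.\<close>
    have sat: "\<pi> -` (\<pi> ` M) = M"
    proof -
      have "x \<in> M" if "m \<in> M" "\<pi> x = \<pi> m" for x m
      proof -
        have "x - m \<in> M"
          using True that(2) exact by (auto simp: star_homomorphismD[OF p(1)])
        then show ?thesis
          using cidealD(2)[OF cM(1) _ that(1), of "x - m"] by simp
      qed
      then show ?thesis by auto
    qed
    then have "\<pi> ` M \<noteq> UNIV"
      using cM(2) by auto
    then obtain K where K: "cideal K" "K \<noteq> UNIV" "\<pi> ` M \<subset> K"
      using in_class_C_larger_cideal[OF assms(4) cideal_image[OF p cM(1)]] by blast
    have "\<pi> -` K = M \<or> \<pi> -` K = UNIV"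
      using maximal_cideal_dichotomy[OF M cideal_vimage[OF p(1) K(1)]] K(3) by blast
    then show False
      using K p(2) by (metis less_irrefl surj_image_vimage_eq image_vimage_eq Int_UNIV_right)
  next
    case False
    have cM: "cideal M"
      using M unfolding maximal_cideal_def proper_cideal_def by auto
    define L where "L = {a + m |a m. a \<in> range \<iota> \<and> m \<in> M}"
    have "cideal L"
      unfolding L_def
    proof (rule cideal_sum[OF cidealD(1-3)[OF ker] cM])
      show "\<exists>a\<in>range \<iota>. \<exists>m\<in>M. e * x = a + m" "\<exists>a\<in>range \<iota>. \<exists>m\<in>M. x * e = a + m"
        if "x \<in> range \<iota>" for e x
        using cidealD(4,5)[OF ker that] cidealD(1)[OF cM] add.right_neutral by metis+
    qed
    moreover have "M \<subseteq> L" "range \<iota> \<subseteq> L"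
      using cidealD(1)[OF ker] cidealD(1)[OF cM] unfolding L_def by force+
    ultimately have "L = UNIV"
      using maximal_cideal_dichotomy[OF M] False by blast
    then have sum: "\<exists>j. \<exists>m\<in>M. x = \<iota> j + m" for x
      unfolding L_def by blast
    \<comment> \<open>The preimage of \<open>M\<close> is not all of \<open>I\<close> because
      \<open>range \<iota>\<close> is not inside \<open>M\<close>.\<close>
    obtain K where K: "cideal K" "K \<noteq> UNIV" "\<iota> -` M \<subset> K"
      using in_class_C_larger_cideal[OF assms(3) cideal_vimage[OF i cM]] False by blast
    define P where "P = {a + m |a m. a \<in> \<iota> ` K \<and> m \<in> M}"
    have "cideal P"
      unfolding P_def
    proof (rule cideal_sum[OF _ _ _ cM])
      show "0 \<in> \<iota> ` K"
        using cidealD(1)[OF K(1)] star_homomorphismD(5)[OF i] by (metis image_eqI)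
      show "x + y \<in> \<iota> ` K" if "x \<in> \<iota> ` K" "y \<in> \<iota> ` K" for x y
        using that cidealD(2)[OF K(1)] by (auto simp flip: star_homomorphismD(1)[OF i])
      show "c *\<^sub>C x \<in> \<iota> ` K" if "x \<in> \<iota> ` K" for c x
        using that cidealD(3)[OF K(1)] by (auto simp flip: star_homomorphismD(2)[OF i])
      fix e x assume "x \<in> \<iota> ` K"
      then obtain k where k: "x = \<iota> k" "k \<in> K" by blast
      \<comment> \<open>Since \<open>I + M = E\<close>, multiplying by \<open>e\<close> amounts,
        modulo \<open>M\<close>, to multiplying by \<open>j\<close> inside \<open>I\<close>, where
        \<open>K\<close> is an ideal.\<close>
      obtain j m where j: "e = \<iota> j + m" "m \<in> M"
        using sum by blast
      have "e * x = \<iota> (j * k) + m * x" "x * e = \<iota> (k * j) + x * m"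
        by (simp_all add: j(1) k(1) distrib_left distrib_right star_homomorphismD[OF i])
      then show "\<exists>a\<in>\<iota> ` K. \<exists>m\<in>M. e * x = a + m" "\<exists>a\<in>\<iota> ` K. \<exists>m\<in>M. x * e = a + m"
        using cidealD(4,5)[OF K(1) k(2)] cidealD(4,5)[OF cM j(2)] by blast+
    qed
    moreover have "M \<subseteq> P" "\<iota> ` K \<subseteq> P"
      using cidealD(1)[OF K(1)] cidealD(1)[OF cM] star_homomorphismD(5)[OF i]
      unfolding P_def by force+
    ultimately have "P = UNIV"
      using maximal_cideal_dichotomy[OF M] K(3) by blast
    \<comment> \<open>The modular law: \<open>K\<close> contains \<open>\<iota> -\<close>
      M\<open>, so\<close>\<iota> \<open>K + M = E\<close> forces \<open>K\<close> to be all of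
      \<open>I\<close>.\<close>
    have "j \<in> K" for j
    proof -
      obtain k m where k: "\<iota> j = \<iota> k + m" "k \<in> K" "m \<in> M"
        using \<open>P = UNIV\<close> unfolding P_def by blast
      then have "\<iota> (j - k) = m"
        by (simp add: star_homomorphismD[OF i])
      then have "j - k \<in> K"
        using k(3) K(3) by blast
      then show ?thesis
        using cidealD(2)[OF K(1) _ k(2), of "j - k"] by simp
    qed
    then show False
      using K(2) by blast
  qed
  ultimately show ?thesis
    unfolding in_class_C_def by blast
qed

end
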